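(* Let $\mathbb{G}=(\mathbb{V},\mathbb{E})$ be a connected, locally finite, vertex-transitive and countably infinite graph, and consider Bernoulli bond percolation on $\mathbb{G}$. For every $p \in [0,1]$ with $p<p_c$, there exist constants $c,C>0$ such that \[ \forall n \ge 0, \quad \psi_n(p) \le C e^{-cn}. \]
   Context: Locally finite means that every vertex has finite degree; vertex-transitive means that for all vertices $v,w$ there is an automorphism of $\mathbb{G}$ mapping $v$ to $w$. Bernoulli bond percolation of parameter $p\in[0,1]$: each edge is open (value $1$) with probability $p$ and closed (value $0$) otherwise, independently of the other edges; $\mathbb{P}_p$ is the corresponding product probability measure on $\{0,1\}^{\mathbb{E}}$. A vertex $o\in\mathbb{V}$ is fixed once and for all. $\mathcal{C}_o$ is the cluster of $o$, i.e. the set of all vertices connected to $o$ by a path of open edges (including $o$ itself), and $|\mathcal{C}_o|$ is its cardinality. The critical probability is \[ p_c = \inf\big\{p\in[0,1] : \mathbb{P}_p[|\mathcal{C}_o|=+\infty]>0\big\}, \] and for every integer $n\ge 0$, $\psi_n(p)=\mathbb{P}_p[|\mathcal{C}_o|\ge n]$. *)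

theory Defs
  imports "HOL-Probability.Probability" "HOL-Library.Extended_Nat"
begin

section \<open>Undirected graphs\<close>

text \<open>Edges are unordered pairs of distinct vertices, encoded as two-element sets.
  The vertex set may be infinite.\<close>

definition simple_graph :: "'a set \<Rightarrow> 'a set set \<Rightarrow> bool" where
  "simple_graph V E \<longleftrightarrow> (\<forall>e\<in>E. \<exists>u\<in>V. \<exists>v\<in>V. u \<noteq> v \<and> e = {u, v})"

definition adj_rel :: "'a set set \<Rightarrow> 'a rel" where
  "adj_rel E = {(u, v). {u, v} \<in> E}"

definition graph_connected :: "'a set \<Rightarrow> 'a set set \<Rightarrow> bool" where
  "graph_connected V E \<longleftrightarrow> (\<forall>u\<in>V. \<forall>v\<in>V. (u, v) \<in> (adj_rel E)\<^sup>*)"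

definition locally_finite_graph :: "'a set \<Rightarrow> 'a set set \<Rightarrow> bool" where
  "locally_finite_graph V E \<longleftrightarrow> (\<forall>v\<in>V. finite {e \<in> E. v \<in> e})"

definition graph_automorphism :: "'a set \<Rightarrow> 'a set set \<Rightarrow> ('a \<Rightarrow> 'a) \<Rightarrow> bool" where
  "graph_automorphism V E f \<longleftrightarrow>
     bij_betw f V V \<and> (\<forall>u\<in>V. \<forall>v\<in>V. {u, v} \<in> E \<longleftrightarrow> {f u, f v} \<in> E)"

definition vertex_transitive :: "'a set \<Rightarrow> 'a set set \<Rightarrow> bool" where
  "vertex_transitive V E \<longleftrightarrow> (\<forall>v\<in>V. \<forall>w\<in>V. \<exists>f. graph_automorphism V E f \<and> f v = w)"

section \<open>Bernoulli bond percolation\<close>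

text \<open>A configuration maps each edge to \<^term>\<open>True\<close> (open, value 1) or \<^term>\<open>False\<close>
  (closed, value 0); outside \<^term>\<open>E\<close> it is \<^term>\<open>undefined\<close>. The library's
  \<^const>\<open>bernoulli_pmf\<close> clamps its parameter to the unit interval, so this is the intended
  measure only for \<^term>\<open>p \<in> {0..1}\<close>.\<close>

definition bond_percolation :: "'a set set \<Rightarrow> real \<Rightarrow> ('a set \<Rightarrow> bool) measure" where
  "bond_percolation E p = (\<Pi>\<^sub>M e\<in>E. measure_pmf (bernoulli_pmf p))"

definition cluster :: "'a set set \<Rightarrow> 'a \<Rightarrow> ('a set \<Rightarrow> bool) \<Rightarrow> 'a set" where
  "cluster E x \<omega> = {y. (x, y) \<in> (adj_rel {e \<in> E. \<omega> e})\<^sup>*}"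

text \<open>Cardinality with value \<open>\<infinity>\<close> on infinite sets, where \<^const>\<open>card\<close> would give 0.\<close>

definition ecardinality :: "'a set \<Rightarrow> enat" where
  "ecardinality A = (if finite A then enat (card A) else \<infinity>)"

definition critical_probability :: "'a set set \<Rightarrow> 'a \<Rightarrow> real" where
  "critical_probability E x =
     Inf {p \<in> {0..1}. measure (bond_percolation E p)
            {\<omega> \<in> space (bond_percolation E p). ecardinality (cluster E x \<omega>) = \<infinity>} > 0}"

definition psi :: "'a set set \<Rightarrow> 'a \<Rightarrow> nat \<Rightarrow> real \<Rightarrow> real" where
  "psi E x n p = measure (bond_percolation E p)
     {\<omega> \<in> space (bond_percolation E p). ecardinality (cluster E x \<omega>) \<ge> enat n}"

end

theory Submission
  imports Defs
begin

text \<open>The idea is to tilt the percolation measure towards small clusters and to observe that the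
  tilted measure still dominates percolation at a slightly smaller parameter.

  Fix \<open>q\<close> with \<open>p < q < p\<^sub>c\<close> and \<open>h > 0\<close>, write \<open>C\<close> for the cluster of \<open>x\<close>, and give each
  configuration the extra weight \<open>exp (- h * |C|)\<close>. Equivalently, colour every vertex green
  with probability \<open>1 - exp (- h)\<close> and condition on \<open>C\<close> containing no green vertex.
  The normalising constant is the Laplace transform \<open>Z = E\<^sub>q[exp (- h * |C|)]\<close>. Explore \<open>C\<close>
  edge by edge. Opening the next boundary edge, with outer endpoint \<open>v\<close>, adds at most one more
  cluster, that of \<open>v\<close>, and this costs a factor of at least \<open>Z\<close> in the conditional expected
  weight, by the supermultiplicativity \<open>laplace_supermultiplicative\<close> and by transitivity. Hence
  under the tilted measure each explored edge is open with conditional probability at least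
  \<open>q * Z\<close>. If \<open>p \<le> q * Z\<close>, percolation at \<open>p\<close> is therefore dominated along the exploration
  (\<open>tilted_domination\<close>), and, for every \<open>n\<close>,
  \<open>P\<^sub>p[|C| \<ge> n] \<le> E\<^sub>q[exp (- h * |C|); |C| \<ge> n] / Z \<le> exp (- h * n) / Z\<close>,
  which is the exponential decay.

  Subcriticality enters only to secure \<open>p \<le> q * Z\<close>: as \<open>q < p\<^sub>c\<close>, the cluster is almost surely
  finite at \<open>q\<close>, so \<open>Z\<close> tends to 1 as \<open>h\<close> tends to 0. Quantitatively,
  \<open>Z \<ge> exp (- h * N) * P\<^sub>q[|C| < N]\<close> (\<open>laplace_ge_finite_psi\<close>), where \<open>N\<close> is chosen first
  and \<open>h\<close> afterwards.

  The exploration argument is carried out for finite edge sets, where it is an induction on the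
  number of edges and expectations are finite sums. Since removing edges can only increase \<open>Z\<close>,
  the constants do not depend on the finite edge set, and the bound passes to the limit along an
  exhaustion of the edges of the graph (\<open>finite_psi_LIMSEQ\<close>).\<close>

section \<open>Expectations over finitely many Bernoulli edges\<close>

text \<open>The integrand is a function of the set \<open>A\<close> of open edges rather than of a
  \<open>{0, 1}\<close>-valued configuration, so that opening an edge is \<^const>\<open>insert\<close> and a cluster is a
  function of \<open>A\<close> alone.\<close>

definition bernoulli_mean :: "real \<Rightarrow> 'b set \<Rightarrow> ('b set \<Rightarrow> real) \<Rightarrow> real" where
  "bernoulli_mean p F g = (\<Sum>A\<in>Pow F. p ^ card A * (1 - p) ^ card (F - A) * g A)"

text \<open>Conditioning on the state of the edge \<open>e\<close>.\<close>

lemma bernoulli_mean_insert: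
  assumes "finite F" "e \<notin> F"
  shows "bernoulli_mean p (insert e F) g =
    p * bernoulli_mean p F (\<lambda>A. g (insert e A)) + (1 - p) * bernoulli_mean p F g"
proof -
  let ?w = "\<lambda>A. p ^ card A * (1 - p) ^ card (insert e F - A) * g A"
  have disj: "Pow F \<inter> insert e ` Pow F = {}"
    using assms by auto
  have inj: "inj_on (insert e) (Pow F)"
    using assms by (auto simp: inj_on_def)
  have closed: "sum ?w (Pow F) = (1 - p) * bernoulli_mean p F g"
    unfolding bernoulli_mean_def sum_distrib_left
  proof (rule sum.cong)
    fix A assume "A \<in> Pow F"
    then have "insert e F - A = insert e (F - A)" "e \<notin> F - A" "finite (F - A)"
      using assms by auto
    then show "?w A = (1 - p) * (p ^ card A * (1 - p) ^ card (F - A) * g A)" by simp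
  qed simp
  have opn: "sum ?w (insert e ` Pow F) = p * bernoulli_mean p F (\<lambda>A. g (insert e A))"
    unfolding bernoulli_mean_def sum_distrib_left sum.reindex[OF inj] o_def
  proof (rule sum.cong)
    fix A assume "A \<in> Pow F"
    then have "insert e F - insert e A = F - A" "e \<notin> A" "finite A"
      using assms by (auto intro: finite_subset)
    then show "?w (insert e A) = p * (p ^ card A * (1 - p) ^ card (F - A) * g (insert e A))" by simp
  qed simp
  show ?thesis
    unfolding bernoulli_mean_def[of p "insert e F"] Pow_insert
    using assms disj closed opn by (subst sum.union_disjoint) auto
qed

lemma bernoulli_mean_const:
  assumes "finite F"
  shows "bernoulli_mean p F (\<lambda>_. c) = c"
  using assms
proof (induction F rule: finite_induct)
  case empty
  show ?case by (simp add: bernoulli_mean_def)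
next
  case (insert e F)
  then show ?case by (simp add: bernoulli_mean_insert algebra_simps)
qed

lemma bernoulli_mean_cmult:
  "bernoulli_mean p F (\<lambda>A. c * g A) = c * bernoulli_mean p F g"
  by (simp add: bernoulli_mean_def sum_distrib_left mult_ac)

lemma bernoulli_mean_mono:
  assumes "0 \<le> p" "p \<le> 1" "\<And>A. A \<subseteq> F \<Longrightarrow> g A \<le> g' A"
  shows "bernoulli_mean p F g \<le> bernoulli_mean p F g'"
  unfolding bernoulli_mean_def using assms by (intro sum_mono mult_left_mono) auto

lemma bernoulli_mean_cong:
  assumes "\<And>A. A \<subseteq> F \<Longrightarrow> g A = g' A"
  shows "bernoulli_mean p F g = bernoulli_mean p F g'"
  unfolding bernoulli_mean_def using assms by (intro sum.cong) auto

lemma bernoulli_mean_diff: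
  "bernoulli_mean p F (\<lambda>A. g A - g' A) = bernoulli_mean p F g - bernoulli_mean p F g'"
  by (simp add: bernoulli_mean_def sum_subtractf algebra_simps)

lemma bernoulli_mean_image:
  assumes "inj_on f F"
  shows "bernoulli_mean p (f ` F) g = bernoulli_mean p F (\<lambda>A. g (f ` A))"
proof -
  have *: "card (f ` A) = card A" "card (f ` F - f ` A) = card (F - A)" if "A \<subseteq> F" for A
  proof -
    show "card (f ` A) = card A" by (meson assms card_image inj_on_subset that)
    have "f ` F - f ` A = f ` (F - A)" using assms that by (auto simp: inj_on_def)
    then show "card (f ` F - f ` A) = card (F - A)" by (metis assms card_image inj_on_subset Diff_subset)
  qed
  show ?thesis
    unfolding bernoulli_mean_def image_Pow_surj[OF refl, symmetric]
    by (subst sum.reindex[OF inj_on_image_Pow[OF assms]]) (auto intro!: sum.cong simp: *)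
qed

section \<open>Clusters of sets of vertices\<close>

definition reach :: "'a set set \<Rightarrow> 'a set \<Rightarrow> 'a set" where
  "reach A S = (adj_rel A)\<^sup>* `` S"

lemma cluster_eq_reach: "cluster E x \<omega> = reach {e \<in> E. \<omega> e} {x}"
  by (auto simp: cluster_def reach_def)

lemma reach_superset: "S \<subseteq> reach A S"
  by (auto simp: reach_def)

lemma reach_insert: "reach A (insert v S) = reach A S \<union> reach A {v}"
  by (auto simp: reach_def)

lemma reach_mono:
  assumes "A \<subseteq> B" "S \<subseteq> T"
  shows "reach A S \<subseteq> reach B T"
proof -
  have "adj_rel A \<subseteq> adj_rel B" using assms by (auto simp: adj_rel_def)
  then have "(adj_rel A)\<^sup>* \<subseteq> (adj_rel B)\<^sup>*" by (rule rtrancl_mono)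
  then show ?thesis using assms unfolding reach_def by blast
qed

lemma reach_step: "u \<in> reach A S \<Longrightarrow> {u, v} \<in> A \<Longrightarrow> v \<in> reach A S"
  unfolding reach_def adj_rel_def by (auto intro: rtrancl_into_rtrancl)

text \<open>\<^term>\<open>reach A S\<close> is the least set that contains \<open>S\<close> and is closed under the edges of \<open>A\<close>; upper
  bounds on clusters below all come from exhibiting such a closed set.\<close>

lemma reach_least:
  assumes "S \<subseteq> T" "\<And>u v. u \<in> T \<Longrightarrow> {u, v} \<in> A \<Longrightarrow> v \<in> T"
  shows "reach A S \<subseteq> T"
proof -
  have "b \<in> T" if "(a, b) \<in> (adj_rel A)\<^sup>*" "a \<in> S" for a b
    using that
  proof (induction rule: rtrancl_induct)
    case base
    then show ?case using assms by auto
  next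
    case (step y z)
    then show ?case using assms(2)[of y z] by (auto simp: adj_rel_def)
  qed
  then show ?thesis by (auto simp: reach_def)
qed

lemma finite_reach:
  assumes "finite (\<Union>A)" "finite S"
  shows "finite (reach A S)"
proof -
  have "reach A S \<subseteq> S \<union> \<Union>A" by (rule reach_least) auto
  then show ?thesis using assms finite_subset by blast
qed

text \<open>This turns opening an edge into enlarging the source, which is why the exploration arguments
  are about clusters of sets of vertices: the source \<open>S\<close> is the part explored so far.\<close>

lemma reach_open_edge:
  assumes "u \<in> S"
  shows "reach (insert {u, v} A) S = reach A (insert v S)"
proof
  have uv: "u \<in> reach A (insert v S)" "v \<in> reach A (insert v S)"
    using reach_superset[of "insert v S" A] assms by auto
  show "reach (insert {u, v} A) S \<subseteq> reach A (insert v S)"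
  proof (rule reach_least)
    show "S \<subseteq> reach A (insert v S)" using reach_superset[of "insert v S" A] by auto
  next
    fix a b assume "a \<in> reach A (insert v S)" "{a, b} \<in> insert {u, v} A"
    then show "b \<in> reach A (insert v S)" using uv by (auto simp: doubleton_eq_iff intro: reach_step)
  qed
  have "u \<in> reach (insert {u, v} A) S"
    using reach_superset[of S "insert {u, v} A"] assms by auto
  then have "v \<in> reach (insert {u, v} A) S" by (rule reach_step) simp
  then show "reach A (insert v S) \<subseteq> reach (insert {u, v} A) S"
    using reach_superset[of S "insert {u, v} A"]
    by (intro reach_least) (auto intro: reach_step)
qed

lemma reach_no_exit:
  assumes "A \<subseteq> F" "\<And>u v. u \<in> S \<Longrightarrow> {u, v} \<in> F \<Longrightarrow> v \<in> S"
  shows "reach A S = S"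
  using assms reach_superset[of S A] by (intro equalityI reach_least) auto

lemma card_reach_mono:
  assumes "A \<subseteq> B" "S \<subseteq> T" "finite (\<Union>B)" "finite T"
  shows "card (reach A S) \<le> card (reach B T)"
  by (intro card_mono finite_reach reach_mono assms)

text \<open>Exploration of the cluster of \<open>S\<close> as an induction principle. Either every edge at \<open>S\<close> stays
  in \<open>S\<close>, and the cluster is \<open>S\<close>; or an edge that leaves \<open>S\<close> is revealed, and the exploration
  goes on among the remaining edges from \<open>S\<close> (edge closed) or from \<open>insert v S\<close> (edge
  open). The recursion is on the number of edges, so \<open>S\<close> may grow.\<close>

lemma exploration_induct [consumes 1, case_names no_exit reveal]:
  assumes "finite F"
    and base: "\<And>F S. finite F \<Longrightarrow> (\<And>u v. u \<in> S \<Longrightarrow> {u, v} \<in> F \<Longrightarrow> v \<in> S) \<Longrightarrow> P F S"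
    and step: "\<And>F S u v. finite F \<Longrightarrow> {u, v} \<notin> F \<Longrightarrow> u \<in> S \<Longrightarrow>
      P F S \<Longrightarrow> P F (insert v S) \<Longrightarrow> P (insert {u, v} F) S"
  shows "P F S"
  using assms(1)
proof (induction F arbitrary: S rule: finite_psubset_induct)
  case (psubset F)
  show ?case
  proof (cases "\<exists>u\<in>S. \<exists>v. v \<notin> S \<and> {u, v} \<in> F")
    case False
    then show ?thesis using base[OF psubset(1)] by blast
  next
    case True
    then obtain u v where uv: "u \<in> S" "{u, v} \<in> F" by blast
    let ?F = "F - {{u, v}}"
    have "?F \<subset> F" and eq: "insert {u, v} ?F = F" using uv by auto
    then have "P ?F S" "P ?F (insert v S)" using psubset.IH by auto
    then have "P (insert {u, v} ?F) S" using psubset(1) uv by (intro step) auto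
    then show ?thesis unfolding eq .
  qed
qed

section \<open>Laplace transform of the cluster size\<close>

definition laplace :: "real \<Rightarrow> real \<Rightarrow> 'a set set \<Rightarrow> 'a set \<Rightarrow> real" where
  "laplace p h F S = bernoulli_mean p F (\<lambda>A. exp (- h * real (card (reach A S))))"

lemma laplace_reveal:
  assumes "finite F" "{u, v} \<notin> F" "u \<in> S"
  shows "laplace p h (insert {u, v} F) S = p * laplace p h F (insert v S) + (1 - p) * laplace p h F S"
  using assms by (simp add: laplace_def bernoulli_mean_insert reach_open_edge)

context
  fixes p h :: real
  assumes p: "0 \<le> p" "p \<le> 1" and h: "0 \<le> h"
begin

lemma laplace_nonneg: "0 \<le> laplace p h F S"
  unfolding laplace_def bernoulli_mean_def using p by (intro sum_nonneg mult_nonneg_nonneg) auto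

lemma laplace_antimono_source:
  assumes "finite (\<Union>F)" "finite T" "S \<subseteq> T"
  shows "laplace p h F T \<le> laplace p h F S"
  unfolding laplace_def
proof (rule bernoulli_mean_mono[OF p])
  fix A assume "A \<subseteq> F"
  then have "finite (\<Union>A)" using assms by (meson Union_mono finite_subset)
  then have "card (reach A S) \<le> card (reach A T)"
    using assms by (intro card_reach_mono) auto
  then show "exp (- h * real (card (reach A T))) \<le> exp (- h * real (card (reach A S)))"
    using h by (simp add: mult_left_mono)
qed

text \<open>A lower bound on the Laplace transform therefore persists when edges have been revealed and
  discarded, which keeps the induction hypotheses below applicable throughout an exploration.\<close>

lemma laplace_antimono_edge:
  assumes "finite F" "finite (\<Union>F)" "finite e" "e \<notin> F" "finite S"
  shows "laplace p h (insert e F) S \<le> laplace p h F S"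
proof -
  have "bernoulli_mean p F (\<lambda>A. exp (- h * real (card (reach (insert e A) S)))) \<le> laplace p h F S"
    unfolding laplace_def
  proof (rule bernoulli_mean_mono[OF p])
    fix A assume "A \<subseteq> F"
    then have "finite (\<Union>A)" using assms by (meson Union_mono finite_subset)
    then have "card (reach A S) \<le> card (reach (insert e A) S)"
      using assms by (intro card_reach_mono) auto
    then show "exp (- h * real (card (reach (insert e A) S))) \<le> exp (- h * real (card (reach A S)))"
      using h by (simp add: mult_left_mono)
  qed
  then have "p * bernoulli_mean p F (\<lambda>A. exp (- h * real (card (reach (insert e A) S))))
      + (1 - p) * laplace p h F S \<le> p * laplace p h F S + (1 - p) * laplace p h F S"
    using p by (intro add_right_mono mult_left_mono)
  then show ?thesis
    using assms by (simp add: laplace_def bernoulli_mean_insert algebra_simps)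
qed

text \<open>The cluster of \<open>insert v S\<close> is the cluster of \<open>S\<close> together with what \<open>v\<close> reaches through
  edges not touched by exploring the former. These are fewer edges, so given the cluster of
  \<open>S\<close> the conditional weight of the addition is at least that of a fresh cluster of \<open>v\<close>. (This
  is also an instance of the Harris inequality; exploring only \<open>S\<close> and leaving \<open>v\<close> aside gives it
  directly.)\<close>

lemma laplace_supermultiplicative:
  assumes "finite F" "finite (\<Union>F)" "finite S"
  shows "laplace p h F S * laplace p h F {v} \<le> laplace p h F (insert v S)"
  using assms
proof (induction F S rule: exploration_induct)
  case (no_exit F S)
  note exit = no_exit(2)
  have S: "laplace p h F S = exp (- h * real (card S))"
  proof -
    have "laplace p h F S = bernoulli_mean p F (\<lambda>_. exp (- h * real (card S)))"
      unfolding laplace_def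
      by (rule bernoulli_mean_cong) (use reach_no_exit[OF _ exit] in simp)
    then show ?thesis using no_exit by (simp add: bernoulli_mean_const)
  qed
  show ?case
    \<comment> \<open>The cluster of \<open>S\<close> is \<open>S\<close> itself, so that subadditivity of the cardinality suffices.\<close>
    unfolding S unfolding laplace_def bernoulli_mean_cmult[symmetric]
  proof (rule bernoulli_mean_mono[OF p])
    fix A assume A: "A \<subseteq> F"
    have "card (reach A (insert v S)) \<le> card S + card (reach A {v})"
      using card_Un_le[of S "reach A {v}"] reach_no_exit[OF A exit] by (simp add: reach_insert[of A v S])
    then have "h * real (card (reach A (insert v S))) \<le> h * (real (card S) + real (card (reach A {v})))"
      using h by (intro mult_left_mono) auto
    then show "exp (- h * real (card S)) * exp (- h * real (card (reach A {v})))
        \<le> exp (- h * real (card (reach A (insert v S))))"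
      by (simp add: exp_add[symmetric] algebra_simps)
  qed
next
  case (reveal F S a b)
  have fin: "finite (\<Union>F)" using reveal by simp
  let ?Z = "laplace p h"
  have IH: "?Z F S * ?Z F {v} \<le> ?Z F (insert v S)"
    "?Z F (insert b S) * ?Z F {v} \<le> ?Z F (insert v (insert b S))"
    using reveal fin by auto
  \<comment> \<open>The cluster of \<open>v\<close> gives up the revealed edge, whatever the state of that edge is.\<close>
  have "?Z (insert {a, b} F) S * ?Z (insert {a, b} F) {v} \<le> ?Z (insert {a, b} F) S * ?Z F {v}"
    using reveal fin by (intro mult_left_mono laplace_antimono_edge laplace_nonneg) auto
  also have "\<dots> = p * (?Z F (insert b S) * ?Z F {v}) + (1 - p) * (?Z F S * ?Z F {v})"
    using reveal by (simp add: laplace_reveal algebra_simps)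
  also have "\<dots> \<le> p * ?Z F (insert v (insert b S)) + (1 - p) * ?Z F (insert v S)"
    using IH p by (intro add_mono mult_left_mono) auto
  also have "\<dots> = ?Z (insert {a, b} F) (insert v S)"
    using reveal by (simp add: laplace_reveal insert_commute)
  finally show ?case .
qed

text \<open>The percolation at parameter \<open>r\<close> is stochastically dominated, for increasing functions of the
  cluster, by percolation at \<open>p\<close> tilted by the weight \<open>exp (- h * |C|)\<close>; the inequality is
  multiplied by the normalising constant. In the inductive step both sides average the two
  outcomes of one edge. The outcome "open" is the more favourable one for \<open>g\<close>, so it suffices that its
  tilted probability is at least \<open>r\<close>.\<close>

lemma tilted_domination:
  fixes g :: "'a set \<Rightarrow> real"
  assumes "finite F" "finite (\<Union>F)" "finite S"
    and r: "0 \<le> r" "r \<le> 1" "\<And>v. v \<in> \<Union>F \<Longrightarrow> r \<le> p * laplace p h F {v}"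
    and g: "\<And>C D. C \<subseteq> D \<Longrightarrow> finite D \<Longrightarrow> g C \<le> g D"
  shows "bernoulli_mean r F (\<lambda>A. g (reach A S)) * laplace p h F S
    \<le> bernoulli_mean p F (\<lambda>A. exp (- h * real (card (reach A S))) * g (reach A S))"
  using assms(1-3) r(3)
proof (induction F S rule: exploration_induct)
  case (no_exit F S)
  note S = reach_no_exit[OF _ no_exit(2)]
  have "bernoulli_mean r F (\<lambda>A. g (reach A S)) = bernoulli_mean r F (\<lambda>_. g S)"
    by (rule bernoulli_mean_cong) (simp add: S)
  moreover have "laplace p h F S = bernoulli_mean p F (\<lambda>_. exp (- h * real (card S)))"
    unfolding laplace_def by (rule bernoulli_mean_cong) (simp add: S)
  moreover have "bernoulli_mean p F (\<lambda>A. exp (- h * real (card (reach A S))) * g (reach A S))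
      = bernoulli_mean p F (\<lambda>_. exp (- h * real (card S)) * g S)"
    by (rule bernoulli_mean_cong) (simp add: S)
  ultimately show ?case using no_exit by (simp add: bernoulli_mean_const)
next
  case (reveal F S u v)
  let ?Z = "laplace p h"
  define a where "a T = bernoulli_mean r F (\<lambda>A. g (reach A T))" for T
  define N where "N T = bernoulli_mean p F (\<lambda>A. exp (- h * real (card (reach A T))) * g (reach A T))" for T
  have fin: "finite (\<Union>F)" using reveal by simp
  have mono: "?Z (insert {u, v} F) {w} \<le> ?Z F {w}" for w
    using reveal fin by (intro laplace_antimono_edge) auto
  have rF: "r \<le> p * ?Z F {w}" if "w \<in> \<Union>(insert {u, v} F)" for w
    using reveal.prems(3)[OF that] mult_left_mono[OF mono[of w] p(1)] by linarith
  then have IH: "a S * ?Z F S \<le> N S" "a (insert v S) * ?Z F (insert v S) \<le> N (insert v S)"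
    unfolding a_def N_def using reveal fin by auto
  have a_mono: "a S \<le> a (insert v S)"
    unfolding a_def
  proof (intro bernoulli_mean_mono r g reach_mono finite_reach)
    fix A assume "A \<subseteq> F"
    then show "finite (\<Union>A)" using fin by (meson Union_mono finite_subset)
  qed (use reveal in auto)
  define W where "W = p * ?Z F (insert v S) + (1 - p) * ?Z F S"
  \<comment> \<open>Under the tilted measure the revealed edge is open with probability
      \<open>p * laplace p h F (insert v S) / W\<close>; the next steps show that this is at least \<open>r\<close>.\<close>
  have "W \<le> ?Z F S"
  proof -
    have "?Z F (insert v S) \<le> ?Z F S" using reveal fin by (intro laplace_antimono_source) auto
    then have "p * ?Z F (insert v S) \<le> p * ?Z F S" using p by (intro mult_left_mono)
    then show ?thesis by (simp add: W_def algebra_simps)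
  qed
  then have "r * W \<le> r * ?Z F S" using r by (intro mult_left_mono)
  also have "\<dots> \<le> (p * ?Z F {v}) * ?Z F S"
    using rF by (intro mult_right_mono laplace_nonneg) auto
  also have "\<dots> = p * (?Z F S * ?Z F {v})" by simp
  also have "\<dots> \<le> p * ?Z F (insert v S)"
    using reveal fin p by (intro mult_left_mono laplace_supermultiplicative) auto
  finally have open_prob: "r * W \<le> p * ?Z F (insert v S)" .
  have "(r * a (insert v S) + (1 - r) * a S) * W = r * W * (a (insert v S) - a S) + a S * W"
    by (simp add: algebra_simps)
  also have "\<dots> \<le> p * ?Z F (insert v S) * (a (insert v S) - a S) + a S * W"
    using open_prob a_mono by (intro add_right_mono mult_right_mono) auto
  also have "\<dots> = p * (a (insert v S) * ?Z F (insert v S)) + (1 - p) * (a S * ?Z F S)"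
    by (simp add: W_def algebra_simps)
  also have "\<dots> \<le> p * N (insert v S) + (1 - p) * N S"
    using IH p by (intro add_mono mult_left_mono) auto
  finally show ?case
    using reveal by (simp add: bernoulli_mean_insert reach_open_edge laplace_reveal a_def N_def W_def)
qed

end

definition finite_psi :: "'a set set \<Rightarrow> 'a \<Rightarrow> nat \<Rightarrow> real \<Rightarrow> real" where
  "finite_psi F x n p = bernoulli_mean p F (\<lambda>A. of_bool (n \<le> card (reach A {x})))"

text \<open>On \<open>|C| \<ge> n\<close> the tilting weight is at most \<open>exp (- h * n)\<close>, so the tilted measure has
  exponential tails, which the domination hands down to parameter \<open>r\<close>.\<close>

lemma finite_psi_exp_bound:
  fixes p r h :: real
  assumes "0 \<le> p" "p \<le> 1" "0 \<le> h" "0 \<le> r" "r \<le> 1" "finite F" "finite (\<Union>F)"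
    and "\<And>v. v \<in> \<Union>F \<Longrightarrow> r \<le> p * laplace p h F {v}"
  shows "finite_psi F x n r * laplace p h F {x} \<le> exp (- h * real n)"
proof -
  have "finite_psi F x n r * laplace p h F {x} \<le>
    bernoulli_mean p F (\<lambda>A. exp (- h * real (card (reach A {x}))) * of_bool (n \<le> card (reach A {x})))"
    unfolding finite_psi_def
    by (rule tilted_domination[where g = "\<lambda>C. of_bool (n \<le> card C)"])
      (use assms in \<open>auto intro: le_trans card_mono\<close>)
  also have "\<dots> \<le> bernoulli_mean p F (\<lambda>_. exp (- h * real n))"
    by (rule bernoulli_mean_mono) (use assms in \<open>auto simp: mult_left_mono\<close>)
  also have "\<dots> = exp (- h * real n)" using assms by (simp add: bernoulli_mean_const)
  finally show ?thesis .
qed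

text \<open>Clusters with fewer than \<open>N\<close> vertices each have weight at least \<open>exp (- h * N)\<close>.\<close>

lemma laplace_ge_finite_psi:
  assumes "0 \<le> p" "p \<le> 1" "0 \<le> h" "finite F"
  shows "exp (- h * real N) * (1 - finite_psi F x N p) \<le> laplace p h F {x}"
proof -
  have "exp (- h * real N) * (1 - finite_psi F x N p)
    = bernoulli_mean p F (\<lambda>A. exp (- h * real N) * (1 - of_bool (N \<le> card (reach A {x}))))"
    using assms by (simp add: finite_psi_def bernoulli_mean_cmult bernoulli_mean_diff bernoulli_mean_const)
  also have "\<dots> \<le> laplace p h F {x}"
    unfolding laplace_def
    by (rule bernoulli_mean_mono) (use assms in \<open>auto simp: mult_left_mono\<close>)
  finally show ?thesis .
qed

section \<open>Finite edge sets inside the infinite graph\<close>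

text \<open>The link between the product measure and finite sums: an event that depends only on the edges of
  \<open>F\<close> is a finite disjoint union of cylinders, one for each possible set of open edges in \<open>F\<close>.\<close>

lemma bond_percolation_cylinder:
  fixes E :: "'a set set"
  assumes "F \<subseteq> E" "finite F" "0 \<le> p" "p \<le> 1"
  shows "{\<omega> \<in> space (bond_percolation E p). P {e \<in> F. \<omega> e}} \<in> sets (bond_percolation E p)" (is ?thesis1)
    and "measure (bond_percolation E p) {\<omega> \<in> space (bond_percolation E p). P {e \<in> F. \<omega> e}}
      = bernoulli_mean p F (\<lambda>A. of_bool (P A))" (is ?thesis2)
proof -
  let ?M = "\<lambda>_ :: 'a set. measure_pmf (bernoulli_pmf p)"
  interpret product_prob_space ?M E by unfold_locales
  let ?B = "bond_percolation E p"
  define cyl where "cyl A = prod_emb E ?M F (\<Pi>\<^sub>E e\<in>F. {e \<in> A})" for A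
  have space: "space ?B = (\<Pi>\<^sub>E e\<in>E. UNIV)" by (simp add: bond_percolation_def space_PiM)
  have cyl_iff: "\<omega> \<in> cyl A \<longleftrightarrow> \<omega> \<in> space ?B \<and> {e \<in> F. \<omega> e} = A" if "A \<subseteq> F" for A \<omega>
    using that assms(1) by (auto simp: cyl_def prod_emb_def space PiE_iff extensional_def restrict_def)
  have sets: "cyl A \<in> sets ?B" for A
    unfolding cyl_def bond_percolation_def using assms by (intro sets_PiM_I) auto
  have meas: "measure ?B (cyl A) = p ^ card A * (1 - p) ^ card (F - A)" if "A \<subseteq> F" for A
  proof -
    have "measure ?B (cyl A) = (\<Prod>e\<in>F. measure (bernoulli_pmf p) {e \<in> A})"
      unfolding cyl_def bond_percolation_def using assms by (subst measure_PiM_emb) auto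
    also have "\<dots> = (\<Prod>e\<in>F. if e \<in> A then p else 1 - p)"
      using assms by (intro prod.cong) (auto simp: measure_pmf_single)
    also have "\<dots> = (\<Prod>e\<in>A. p) * (\<Prod>e\<in>F - A. 1 - p)"
      using assms that by (simp add: prod.If_cases Int_absorb1 Diff_eq)
    finally show ?thesis by simp
  qed
  have eq: "{\<omega> \<in> space ?B. P {e \<in> F. \<omega> e}} = (\<Union>A\<in>{A \<in> Pow F. P A}. cyl A)"
    using cyl_iff by auto
  show ?thesis1
    unfolding eq using assms sets by (intro sets.finite_UN) auto
  have "measure ?B (\<Union>A\<in>{A \<in> Pow F. P A}. cyl A) = (\<Sum>A\<in>{A \<in> Pow F. P A}. measure ?B (cyl A))"
  proof (rule measure_finite_Union)
    show "disjoint_family_on cyl {A \<in> Pow F. P A}"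
      by (auto simp: disjoint_family_on_def cyl_iff)
    show "emeasure ?B (cyl A) \<noteq> \<infinity>" for A
      unfolding bond_percolation_def by simp
  qed (use assms sets in auto)
  also have "\<dots> = bernoulli_mean p F (\<lambda>A. of_bool (P A))"
    unfolding bernoulli_mean_def using assms
    by (intro sum.mono_neutral_cong_left) (auto simp: meas)
  finally show ?thesis2 unfolding eq .
qed

lemma prob_space_bond_percolation: "prob_space (bond_percolation E p)"
  unfolding bond_percolation_def by (intro prob_space_PiM measure_pmf.prob_space_axioms)

definition edge_prefix :: "'b set \<Rightarrow> nat \<Rightarrow> 'b set" where
  "edge_prefix E k = {e \<in> E. to_nat_on E e \<le> k}"

lemma finite_edge_prefix: "countable E \<Longrightarrow> finite (edge_prefix E k)"
  unfolding edge_prefix_def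
  by (rule inj_on_finite[of "to_nat_on E" _ "{..k}"])
    (auto intro: inj_on_subset[OF inj_on_to_nat_on])

lemma edge_prefix_mono: "i \<le> j \<Longrightarrow> edge_prefix E i \<subseteq> edge_prefix E j"
  by (auto simp: edge_prefix_def)

lemma reach_edge_prefix:
  assumes "y \<in> reach {e \<in> E. \<omega> e} S"
  shows "\<exists>k. y \<in> reach {e \<in> edge_prefix E k. \<omega> e} S"
proof -
  let ?R = "\<lambda>k. reach {e \<in> edge_prefix E k. \<omega> e} S"
  have mono: "?R i \<subseteq> ?R j" if "i \<le> j" for i j
    using edge_prefix_mono[OF that, of E] by (intro reach_mono) auto
  have "reach {e \<in> E. \<omega> e} S \<subseteq> (\<Union>k. ?R k)"
  proof (rule reach_least)
    show "S \<subseteq> (\<Union>k. ?R k)" using reach_superset by fastforce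
  next
    fix u v assume "u \<in> (\<Union>k. ?R k)" and e: "{u, v} \<in> {e \<in> E. \<omega> e}"
    then obtain k where k: "u \<in> ?R k" by auto
    define m where "m = max k (to_nat_on E {u, v})"
    have "u \<in> ?R m" using k mono[of k m] by (auto simp: m_def)
    moreover have "{u, v} \<in> {e \<in> edge_prefix E m. \<omega> e}"
      using e by (auto simp: edge_prefix_def m_def)
    ultimately have "v \<in> ?R m" by (rule reach_step)
    then show "v \<in> (\<Union>k. ?R k)" by blast
  qed
  then show ?thesis using assms by auto
qed

lemma ecardinality_geD:
  assumes "enat n \<le> ecardinality C"
  shows "\<exists>T\<subseteq>C. finite T \<and> card T = n"
proof -
  have "infinite C \<or> n \<le> card C" using assms by (auto simp: ecardinality_def split: if_splits)
  then show ?thesis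
    by (metis infinite_arbitrarily_large obtain_subset_with_card_n finite_subset)
qed

lemma ecardinality_geI: "n \<le> card D \<Longrightarrow> D \<subseteq> C \<Longrightarrow> enat n \<le> ecardinality C"
  by (auto simp: ecardinality_def intro: le_trans card_mono)

text \<open>A cluster has \<open>n\<close> vertices once finitely many open paths exist, and these use finitely many
  edges. This gives both the measurability of the event and its approximation by finite edge sets.\<close>

lemma large_cluster_iff:
  assumes "countable E" "\<And>e. e \<in> E \<Longrightarrow> finite e"
  shows "enat n \<le> ecardinality (cluster E x \<omega>)
    \<longleftrightarrow> (\<exists>k. n \<le> card (reach {e \<in> edge_prefix E k. \<omega> e} {x}))"
proof -
  let ?R = "\<lambda>k. reach {e \<in> edge_prefix E k. \<omega> e} {x}"
  have fin: "finite (?R k)" for k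
  proof (rule finite_reach)
    have "finite {e \<in> edge_prefix E k. \<omega> e}" using finite_edge_prefix[OF assms(1)] by simp
    then show "finite (\<Union>{e \<in> edge_prefix E k. \<omega> e})"
      using assms(2) by (rule finite_Union) (simp add: edge_prefix_def)
  qed simp
  show ?thesis
  proof
    assume "enat n \<le> ecardinality (cluster E x \<omega>)"
    then obtain T where T: "T \<subseteq> cluster E x \<omega>" "finite T" "card T = n"
      by (blast dest: ecardinality_geD)
    then have "\<forall>y\<in>T. \<exists>k. y \<in> ?R k"
      unfolding cluster_eq_reach using reach_edge_prefix by fast
    then obtain f where f: "\<And>y. y \<in> T \<Longrightarrow> y \<in> ?R (f y)" by metis
    obtain m where m: "\<And>y. y \<in> T \<Longrightarrow> f y \<le> m"
      using finite_nat_set_iff_bounded_le[of "f ` T"] T by auto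
    have "T \<subseteq> ?R m"
    proof
      fix y assume y: "y \<in> T"
      have "?R (f y) \<subseteq> ?R m"
        using edge_prefix_mono[OF m[OF y], of E] by (intro reach_mono) auto
      then show "y \<in> ?R m" using f[OF y] by auto
    qed
    then have "n \<le> card (?R m)" using T fin card_mono by blast
    then show "\<exists>k. n \<le> card (?R k)" by blast
  next
    assume "\<exists>k. n \<le> card (?R k)"
    then obtain k where "n \<le> card (?R k)" by auto
    moreover have "?R k \<subseteq> cluster E x \<omega>"
      unfolding cluster_eq_reach by (intro reach_mono) (auto simp: edge_prefix_def)
    ultimately show "enat n \<le> ecardinality (cluster E x \<omega>)"
      by (rule ecardinality_geI)
  qed
qed

context
  fixes E :: "'a set set" and p :: real
  assumes E: "countable E" "\<And>e. e \<in> E \<Longrightarrow> finite e" and p: "0 \<le> p" "p \<le> 1"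
begin

interpretation prob_space "bond_percolation E p" by (rule prob_space_bond_percolation)

lemma large_cluster_measurable:
  "{\<omega> \<in> space (bond_percolation E p). enat n \<le> ecardinality (cluster E x \<omega>)}
    \<in> sets (bond_percolation E p)"
proof -
  have "{\<omega> \<in> space (bond_percolation E p). enat n \<le> ecardinality (cluster E x \<omega>)}
    = (\<Union>k. {\<omega> \<in> space (bond_percolation E p). n \<le> card (reach {e \<in> edge_prefix E k. \<omega> e} {x})})"
    using large_cluster_iff[OF E] by auto
  also have "\<dots> \<in> sets (bond_percolation E p)"
    using p E by (intro sets.countable_UN image_subsetI
        bond_percolation_cylinder(1)[where P = "\<lambda>A. n \<le> card (reach A {x})"] finite_edge_prefix)
      (auto simp: edge_prefix_def)
  finally show ?thesis .
qed

lemma finite_psi_LIMSEQ: "(\<lambda>k. finite_psi (edge_prefix E k) x n p) \<longlonglongrightarrow> psi E x n p"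
proof -
  let ?B = "bond_percolation E p"
  define X where "X k = {\<omega> \<in> space ?B. n \<le> card (reach {e \<in> edge_prefix E k. \<omega> e} {x})}" for k
  have sub: "edge_prefix E k \<subseteq> E" for k by (auto simp: edge_prefix_def)
  note cyl = bond_percolation_cylinder[OF sub finite_edge_prefix[OF E(1)] p,
      where P = "\<lambda>A. n \<le> card (reach A {x})"]
  have "(\<lambda>k. measure ?B (X k)) \<longlonglongrightarrow> measure ?B (\<Union>k. X k)"
  proof (rule finite_Lim_measure_incseq)
    show "range X \<subseteq> events" using cyl(1) by (auto simp: X_def)
    have mono: "card (reach {e \<in> edge_prefix E i. \<omega> e} {x}) \<le> card (reach {e \<in> edge_prefix E j. \<omega> e} {x})"
      if "i \<le> j" for i j \<omega>
    proof (rule card_reach_mono)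
      show "{e \<in> edge_prefix E i. \<omega> e} \<subseteq> {e \<in> edge_prefix E j. \<omega> e}"
        using edge_prefix_mono[OF that, of E] by auto
      have "finite {e \<in> edge_prefix E j. \<omega> e}" using finite_edge_prefix[OF E(1)] by simp
      then show "finite (\<Union>{e \<in> edge_prefix E j. \<omega> e})"
        using E(2) by (rule finite_Union) (simp add: edge_prefix_def)
    qed simp_all
    have "X i \<subseteq> X j" if "i \<le> j" for i j
      unfolding X_def using mono[OF that] le_trans by blast
    then show "incseq X" by (simp add: incseq_def)
  qed
  moreover have "measure ?B (X k) = finite_psi (edge_prefix E k) x n p" for k
    unfolding X_def finite_psi_def by (rule cyl(2))
  moreover have "(\<Union>k. X k) = {\<omega> \<in> space ?B. enat n \<le> ecardinality (cluster E x \<omega>)}"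
    using large_cluster_iff[OF E] by (auto simp: X_def)
  ultimately show ?thesis by (simp add: psi_def)
qed

lemma finite_psi_le_psi:
  assumes "F \<subseteq> E" "finite F"
  shows "finite_psi F x n p \<le> psi E x n p"
proof -
  let ?B = "bond_percolation E p"
  have "finite_psi F x n p = measure ?B {\<omega> \<in> space ?B. n \<le> card (reach {e \<in> F. \<omega> e} {x})}"
    unfolding finite_psi_def using assms p
    by (subst bond_percolation_cylinder(2)[where P = "\<lambda>A. n \<le> card (reach A {x})"]) auto
  also have "\<dots> \<le> psi E x n p"
    unfolding psi_def
  proof (rule finite_measure_mono[OF _ large_cluster_measurable], safe)
    fix \<omega> assume n: "n \<le> card (reach {e \<in> F. \<omega> e} {x})"
    have "reach {e \<in> F. \<omega> e} {x} \<subseteq> cluster E x \<omega>"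
      unfolding cluster_eq_reach using assms by (intro reach_mono) auto
    with n show "enat n \<le> ecardinality (cluster E x \<omega>)"
      by (rule ecardinality_geI)
  qed
  finally show ?thesis .
qed

lemma psi_LIMSEQ:
  "(\<lambda>n. psi E x n p) \<longlonglongrightarrow> measure (bond_percolation E p)
     {\<omega> \<in> space (bond_percolation E p). ecardinality (cluster E x \<omega>) = \<infinity>}"
proof -
  let ?B = "bond_percolation E p"
  define Y where "Y n = {\<omega> \<in> space ?B. enat n \<le> ecardinality (cluster E x \<omega>)}" for n
  have "(\<lambda>n. measure ?B (Y n)) \<longlonglongrightarrow> measure ?B (\<Inter>n. Y n)"
  proof (rule finite_Lim_measure_decseq)
    show "range Y \<subseteq> events" using large_cluster_measurable by (auto simp: Y_def)
    show "decseq Y" by (auto simp: decseq_def Y_def elim: order_trans[rotated])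
  qed
  moreover have "c = \<infinity> \<longleftrightarrow> (\<forall>n. enat n \<le> c)" for c
    by (cases c) (auto simp: not_le intro: lessI)
  then have "(\<Inter>n. Y n) = {\<omega> \<in> space ?B. ecardinality (cluster E x \<omega>) = \<infinity>}"
    by (auto simp: Y_def)
  ultimately show ?thesis by (simp add: psi_def Y_def)
qed

lemma psi_LIMSEQ_0_subcritical:
  assumes "p < critical_probability E x"
  shows "(\<lambda>n. psi E x n p) \<longlonglongrightarrow> 0"
proof -
  let ?I = "\<lambda>q. measure (bond_percolation E q)
     {\<omega> \<in> space (bond_percolation E q). ecardinality (cluster E x \<omega>) = \<infinity>}"
  have "\<not> 0 < ?I p"
  proof
    assume "0 < ?I p"
    then have "Inf {q \<in> {0..1}. 0 < ?I q} \<le> p"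
      using p by (intro cInf_lower) (auto intro: bdd_belowI[of _ 0])
    then show False using assms by (simp add: critical_probability_def)
  qed
  then have "?I p = 0" using measure_nonneg antisym_conv3 not_less by metis
  then show ?thesis using psi_LIMSEQ[of x] by simp
qed

end

section \<open>Transitivity and the trivial upper bound on the critical probability\<close>

text \<open>Automorphisms are applied to a finite edge set, where they merely reindex a finite sum; the
  image of \<open>F\<close> is again a finite set of edges of the graph, and hence is governed by the same
  \<^const>\<open>psi\<close> at the base vertex.\<close>

lemma finite_psi_automorphism:
  assumes "simple_graph V E" "graph_automorphism V E f" "v \<in> V" "F \<subseteq> E" "finite F"
    and "0 \<le> p" "p \<le> 1"
  shows "(`) f ` F \<subseteq> E" and "finite_psi F v n p \<le> finite_psi ((`) f ` F) (f v) n p"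
proof -
  have edge: "\<exists>a\<in>V. \<exists>b\<in>V. e = {a, b}" if "e \<in> E" for e
    using assms(1) that unfolding simple_graph_def by blast
  have f: "inj_on f V" and fE: "\<And>a b. a \<in> V \<Longrightarrow> b \<in> V \<Longrightarrow> {a, b} \<in> E \<Longrightarrow> {f a, f b} \<in> E"
    using assms(2) by (auto simp: graph_automorphism_def bij_betw_def)
  have EV: "E \<subseteq> Pow V" using edge by blast
  show "(`) f ` F \<subseteq> E"
  proof
    fix e assume "e \<in> (`) f ` F"
    then obtain d where "d \<in> E" "e = f ` d" using assms by auto
    then show "e \<in> E" using edge[of d] fE by auto
  qed
  have inj: "inj_on ((`) f) F"
    using inj_on_image_Pow[OF f] EV assms(4) inj_on_subset by blast
  have "card (reach A {v}) \<le> card (reach ((`) f ` A) {f v})" if A: "A \<subseteq> F" for A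
  proof -
    have V: "reach A {v} \<subseteq> V"
      using assms A EV by (intro reach_least) auto
    have "reach A {v} \<subseteq> {y. f y \<in> reach ((`) f ` A) {f v}}"
    proof (rule reach_least)
      show "{v} \<subseteq> {y. f y \<in> reach ((`) f ` A) {f v}}"
        using reach_superset[of "{f v}"] by auto
    next
      fix a b assume "a \<in> {y. f y \<in> reach ((`) f ` A) {f v}}" and ab: "{a, b} \<in> A"
      moreover have "{f a, f b} \<in> (`) f ` A" using imageI[OF ab, of "(`) f"] by simp
      ultimately show "b \<in> {y. f y \<in> reach ((`) f ` A) {f v}}" by (auto intro: reach_step)
    qed
    then have "f ` reach A {v} \<subseteq> reach ((`) f ` A) {f v}" by auto
    moreover have "finite (\<Union>((`) f ` A))"
    proof -
      have "finite A" using A assms by (meson finite_subset)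
      moreover have "finite e" if "e \<in> A" for e using edge[of e] that A assms by auto
      ultimately show ?thesis by auto
    qed
    ultimately have "card (f ` reach A {v}) \<le> card (reach ((`) f ` A) {f v})"
      by (intro card_mono finite_reach) auto
    then show ?thesis using card_image[OF inj_on_subset[OF f V]] by simp
  qed
  then show "finite_psi F v n p \<le> finite_psi ((`) f ` F) (f v) n p"
    unfolding finite_psi_def bernoulli_mean_image[OF inj] using assms
    by (intro bernoulli_mean_mono) (auto intro: le_trans)
qed

text \<open>Together with \<open>psi_LIMSEQ_0_subcritical\<close> this excludes \<open>p = 1\<close> in the theorem, which leaves room
  for a second subcritical parameter \<open>q \<le> 1\<close> above \<open>p\<close>.\<close>

lemma psi_at_one:
  assumes "countable E" "\<And>e. e \<in> E \<Longrightarrow> finite e" "infinite (reach E {x})"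
  shows "psi E x n 1 = 1"
proof -
  have "enat n \<le> ecardinality (cluster E x (\<lambda>_. True))"
    using assms by (simp add: cluster_eq_reach ecardinality_def)
  then obtain k where k: "n \<le> card (reach (edge_prefix E k) {x})"
    using large_cluster_iff[OF assms(1,2)] by auto
  let ?F = "edge_prefix E k"
  have fin: "finite ?F" using assms by (simp add: finite_edge_prefix)
  \<comment> \<open>At \<open>p = 1\<close> only the configuration with all edges of the finite set open has mass.\<close>
  have "finite_psi ?F x n 1 = (\<Sum>A\<in>{?F}. 1)"
    unfolding finite_psi_def bernoulli_mean_def
  proof (rule sum.mono_neutral_cong_right)
    show "\<forall>A\<in>Pow ?F - {?F}. 1 ^ card A * (1 - 1) ^ card (?F - A) * of_bool (n \<le> card (reach A {x})) = (0::real)"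
    proof
      fix A assume "A \<in> Pow ?F - {?F}"
      then have "?F - A \<noteq> {}" by auto
      then have "card (?F - A) \<noteq> 0" using fin by simp
      then show "1 ^ card A * (1 - 1) ^ card (?F - A) * of_bool (n \<le> card (reach A {x})) = (0::real)"
        by simp
    qed
  qed (use fin k in auto)
  then have "1 \<le> psi E x n 1"
    using finite_psi_le_psi[OF assms(1,2), of 1 ?F x n] fin by (auto simp: edge_prefix_def)
  moreover have "psi E x n 1 \<le> 1"
    unfolding psi_def by (rule prob_space.prob_le_1[OF prob_space_bond_percolation])
  ultimately show ?thesis by simp
qed

section \<open>Exponential decay\<close>

text \<open>The finite bounds are uniform, hence survive the exhaustion of the graph.\<close>

lemma psi_exp_bound:
  fixes p q h z :: real
  assumes E: "countable E" "\<And>e. e \<in> E \<Longrightarrow> finite e"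
    and p: "0 \<le> p" "p \<le> 1" and q: "0 \<le> q" "q \<le> 1" and h: "0 \<le> h"
    and z: "0 < z" "p \<le> q * z"
    and Z: "\<And>F v. F \<subseteq> E \<Longrightarrow> finite F \<Longrightarrow> v \<in> insert x (\<Union>F) \<Longrightarrow> z \<le> laplace q h F {v}"
  shows "psi E x n p \<le> 1 / z * exp (- h * real n)"
proof (rule LIMSEQ_le_const2[OF finite_psi_LIMSEQ[OF E p]])
  have bound: "finite_psi F x n p \<le> 1 / z * exp (- h * real n)" if F: "F \<subseteq> E" "finite F" for F
  proof -
    have "finite_psi F x n p * z \<le> finite_psi F x n p * laplace q h F {x}"
      using Z[OF F] p unfolding finite_psi_def bernoulli_mean_def
      by (intro mult_left_mono sum_nonneg) auto
    also have "\<dots> \<le> exp (- h * real n)"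
    proof (rule finite_psi_exp_bound)
      show "finite (\<Union>F)" using F E(2) by auto
      fix v assume "v \<in> \<Union>F"
      then have "q * z \<le> q * laplace q h F {v}" using Z[OF F] q by (intro mult_left_mono) auto
      then show "p \<le> q * laplace q h F {v}" using z by linarith
    qed (use h p q F in auto)
    finally show ?thesis using z by (simp add: field_simps)
  qed
  then show "\<exists>K. \<forall>k\<ge>K. finite_psi (edge_prefix E k) x n p \<le> 1 / z * exp (- h * real n)"
    using finite_edge_prefix[OF E(1)] by (auto simp: edge_prefix_def)
qed

text \<open>The Laplace transform of a cluster is close to 1 for small \<open>h\<close>, uniformly in the finite edge
  set and the vertex, as soon as some tail of the cluster size has small probability. One factor
  \<open>s\<close> accounts for the probability that the cluster is small, the other for its weight.\<close>

lemma laplace_lower_bound: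
  assumes "simple_graph V E" "vertex_transitive V E" "countable E" "\<And>e. e \<in> E \<Longrightarrow> finite e"
    and "x \<in> V" "v \<in> V" and F: "F \<subseteq> E" "finite F" and q: "0 \<le> q" "q \<le> 1"
    and N: "psi E x N q \<le> 1 - s" and h: "0 \<le> h" "h * real N \<le> 1 - s" and s: "0 \<le> s"
  shows "s\<^sup>2 \<le> laplace q h F {v}"
proof -
  obtain f where f: "graph_automorphism V E f" "f v = x"
    using assms(2,5,6) unfolding vertex_transitive_def by blast
  note aut = finite_psi_automorphism[OF assms(1) f(1) assms(6) F q]
  have "finite_psi F v N q \<le> psi E x N q"
    using aut(2)[of N] finite_psi_le_psi[OF assms(3,4) q aut(1), of x N] F(2) f(2) by simp
  then have "s \<le> 1 - finite_psi F v N q" using N by simp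
  moreover have "s \<le> exp (- h * real N)" using exp_ge_add_one_self[of "- h * real N"] h by simp
  ultimately have "s * s \<le> exp (- h * real N) * (1 - finite_psi F v N q)"
    using s by (intro mult_mono) auto
  also have "\<dots> \<le> laplace q h F {v}" using h q F by (intro laplace_ge_finite_psi) auto
  finally show ?thesis by (simp add: power2_eq_square)
qed

theorem theorem1:
  fixes V :: "'a set" and E :: "'a set set" and x :: 'a and p :: real
  assumes "simple_graph V E"
    and "graph_connected V E"
    and "locally_finite_graph V E"
    and "vertex_transitive V E"
    and "countable V" and "infinite V"
    and "x \<in> V"
    and "p \<in> {0..1}" and "p < critical_probability E x"
  shows "\<exists>c>0. \<exists>C>0. \<forall>n::nat. psi E x n p \<le> C * exp (- c * real n)"
proof -
  have edge: "\<exists>a\<in>V. \<exists>b\<in>V. e = {a, b}" if "e \<in> E" for e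
    using assms(1) that unfolding simple_graph_def by blast
  have finE: "finite e" if "e \<in> E" for e using edge[OF that] by auto
  have cE: "countable E"
  proof (rule countable_subset)
    show "E \<subseteq> (\<lambda>(a, b). {a, b}) ` (V \<times> V)" using edge by fastforce
    show "countable ((\<lambda>(a, b). {a, b}) ` (V \<times> V))" using assms by auto
  qed
  have "V \<subseteq> reach E {x}" using assms by (auto simp: graph_connected_def reach_def)
  then have "infinite (reach E {x})" using assms finite_subset by blast
  then have one: "psi E x n 1 = 1" for n using cE finE by (intro psi_at_one)
  have "p \<noteq> 1"
  proof
    assume "p = 1"
    then have "(\<lambda>n. psi E x n 1) \<longlonglongrightarrow> 0"
      using assms by (intro psi_LIMSEQ_0_subcritical cE finE) auto
    then show False by (simp add: one LIMSEQ_const_iff)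
  qed
  then obtain q where q: "p < q" "q < critical_probability E x" "q < 1"
    using assms dense[of p "min 1 (critical_probability E x)"] by auto
  have pq: "0 \<le> p" "p \<le> 1" "0 \<le> q" "q \<le> 1" "0 < q" using q assms by auto
  \<comment> \<open>The midpoint \<open>s\<close> of \<open>p / q\<close> and 1 satisfies \<open>s\<^sup>2 \<ge> p / q\<close>.\<close>
  define s where "s = (1 + p / q) / 2"
  have s: "1 / 2 \<le> s" "s < 1" using q pq by (auto simp: s_def)
  have "((1 + t) / 2)\<^sup>2 - t = ((1 - t) / 2)\<^sup>2" for t :: real
    by (simp add: power2_eq_square field_simps)
  then have "s\<^sup>2 - p / q = ((1 - p / q) / 2)\<^sup>2" unfolding s_def .
  then have "p / q \<le> s\<^sup>2" using zero_le_power2[of "(1 - p / q) / 2"] by linarith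
  then have ps: "p \<le> q * s\<^sup>2" using pq by (simp add: field_simps)
  have "(\<lambda>n. psi E x n q) \<longlonglongrightarrow> 0"
    using pq q by (intro psi_LIMSEQ_0_subcritical cE finE)
  then have "\<forall>\<^sub>F n in sequentially. psi E x n q < 1 - s"
    using s by (intro order_tendstoD) auto
  then obtain N0 where "\<And>n. n \<ge> N0 \<Longrightarrow> psi E x n q < 1 - s"
    by (auto simp: eventually_sequentially)
  then obtain N where N: "0 < N" "psi E x N q < 1 - s" by (metis le_add1 zero_less_Suc add_Suc_right)
  define h where "h = (1 - s) / real N"
  have h: "0 < h" "h * real N = 1 - s" using s N by (auto simp: h_def)
  have "psi E x n p \<le> 1 / s\<^sup>2 * exp (- h * real n)" for n
  proof (rule psi_exp_bound[OF cE finE pq(1-4)])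
    fix F v assume F: "F \<subseteq> E" "finite F" and "v \<in> insert x (\<Union>F)"
    then consider "v = x" | e where "e \<in> E" "v \<in> e" by auto
    then have "v \<in> V" using edge assms(7) by cases fastforce+
    then show "s\<^sup>2 \<le> laplace q h F {v}"
      using N h s by (intro laplace_lower_bound[OF assms(1,4) cE finE assms(7) _ F pq(3,4), where N = N]) auto
  qed (use h s ps in auto)
  moreover have "0 < 1 / s\<^sup>2" using s by simp
  ultimately show ?thesis using h by blast
qed

end
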